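(* For every positive integer $n$, there is a neighborly family of $n$ congruent convex $3$-polytopes in $\mathbb{R}^3$, each of which has a plane of bilateral symmetry, a line of $180$-degree rotational symmetry, and a point of central symmetry.
   Context: A convex $d$-polytope is a bounded intersection of finitely many closed halfspaces in $\mathbb{R}^d$ that has nonempty interior. A family of $d$-dimensional convex polytopes in $\mathbb{R}^d$ is neighborly if every two distinct members of the family have a $(d-1)$-dimensional intersection. Polytopes are congruent if each is the image of any other under an isometry of $\mathbb{R}^d$. A polytope $P\subset\mathbb{R}^3$ has a plane of bilateral symmetry if some reflection across a plane maps $P$ to itself; a line of $180$-degree rotational symmetry if the $180$-degree rotation about some line maps $P$ to itself; and a point of central symmetry if the point reflection through some point maps $P$ to itself. *)

theory Defs
  imports "HOL-Analysis.Analysis"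
begin

(* polyhedron: a finite intersection of closed halfspaces. *)
definition convex_full_polytope :: "'a::euclidean_space set \<Rightarrow> bool" where
  "convex_full_polytope P \<longleftrightarrow> polyhedron P \<and> bounded P \<and> interior P \<noteq> {}"

definition neighborly :: "'a::euclidean_space set set \<Rightarrow> bool" where
  "neighborly F \<longleftrightarrow>
     (\<forall>P\<in>F. \<forall>Q\<in>F. P \<noteq> Q \<longrightarrow> aff_dim (P \<inter> Q) = int DIM('a) - 1)"

(* Surjectivity need not be demanded: a distance-preserving self-map of a
   Euclidean space is automatically bijective. *)
definition isometry :: "('a::euclidean_space \<Rightarrow> 'a) \<Rightarrow> bool" where
  "isometry f \<longleftrightarrow> (\<forall>x y. dist (f x) (f y) = dist x y)"

definition congruent_sets :: "'a::euclidean_space set \<Rightarrow> 'a set \<Rightarrow> bool" where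
  "congruent_sets P Q \<longleftrightarrow> (\<exists>f. isometry f \<and> f ` P = Q)"

(* The plane passes through p with normal vector a: the component of x - p
   along a is reversed. *)
definition plane_reflection :: "real^3 \<Rightarrow> real^3 \<Rightarrow> real^3 \<Rightarrow> real^3" where
  "plane_reflection p a x = x - (2 * (((x - p) \<bullet> a) / (a \<bullet> a))) *\<^sub>R a"

(* Rotation by 180 degrees about the line through p with direction u: with foot
   the orthogonal projection of x onto the line, foot + (x - foot) is sent to
   foot - (x - foot). *)
definition half_turn :: "real^3 \<Rightarrow> real^3 \<Rightarrow> real^3 \<Rightarrow> real^3" where
  "half_turn p u x =
     (let foot = p + (((x - p) \<bullet> u) / (u \<bullet> u)) *\<^sub>R u in foot - (x - foot))"

definition point_reflection :: "real^3 \<Rightarrow> real^3 \<Rightarrow> real^3" where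
  "point_reflection c x = c - (x - c)"

definition has_plane_of_bilateral_symmetry :: "(real^3) set \<Rightarrow> bool" where
  "has_plane_of_bilateral_symmetry P \<longleftrightarrow> (\<exists>p a. a \<noteq> 0 \<and> plane_reflection p a ` P = P)"

definition has_line_of_half_turn_symmetry :: "(real^3) set \<Rightarrow> bool" where
  "has_line_of_half_turn_symmetry P \<longleftrightarrow> (\<exists>p u. u \<noteq> 0 \<and> half_turn p u ` P = P)"

definition has_point_of_central_symmetry :: "(real^3) set \<Rightarrow> bool" where
  "has_point_of_central_symmetry P \<longleftrightarrow> (\<exists>c. point_reflection c ` P = P)"

end

(* Take finitely many equally spaced points on the helix (u, cos u, sin u), spanning less than one
   turn. A sphere tangent to the helix at two of them has no other of them in its closed ball, so the
   Voronoi regions of any two share a 2-dimensional face near the centre of that sphere, and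
   powers of a screw motion carry the regions to each other. The region of the point with parameter 0
   is invariant under the half turn about the normal line of the helix there. Intersect it with its
   mirror image in a plane orthogonal to that line and with a large box centred on that plane. If
   the plane is far away, this keeps all the contact points, and the resulting polytope is
   symmetric under the reflection, the half turn, and hence their composition, a point
   reflection. *)

theory Submission
  imports Defs
begin

section \<open>Invariance under isometries\<close>

text \<open>Subtracting \<open>f 0\<close> leaves a distance-preserving map that fixes the origin,
  and such a map is linear and orthogonal.\<close>

lemma isometry_orthogonal:
  assumes "isometry f"
  obtains A where "orthogonal_transformation A" "f = (\<lambda>x. f 0 + A x)"
proof
  show "orthogonal_transformation (\<lambda>x. f x - f 0)"
    using assms by (simp add: isometry_def orthogonal_transformation_isometry dist_norm)
qed simp

lemma isometry_imp_inj: "isometry f \<Longrightarrow> inj f"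
  unfolding isometry_def inj_on_def by (metis dist_eq_0_iff)

lemma isometry_funpow: "isometry f \<Longrightarrow> isometry (f ^^ n)"
  by (induction n) (auto simp: isometry_def)

lemma isometry_image_cong:
  assumes "isometry f"
  obtains a A where "orthogonal_transformation A" "\<And>S. f ` S = (+) a ` A ` S"
proof -
  obtain A where A: "orthogonal_transformation A" "f = (\<lambda>x. f 0 + A x)"
    using assms by (rule isometry_orthogonal)
  have "f ` S = (+) (f 0) ` A ` S" for S
    by (subst A(2)) auto
  with A(1) show thesis by (rule that)
qed

lemma aff_dim_isometry_image:
  assumes "isometry f"
  shows "aff_dim (f ` S) = aff_dim S"
proof -
  obtain a A where A: "orthogonal_transformation A" "\<And>S. f ` S = (+) a ` A ` S"
    using assms by (rule isometry_image_cong) blast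
  then show ?thesis
    by (simp add: aff_dim_translation_eq orthogonal_transformation_linear orthogonal_transformation_inj)
qed

lemma convex_full_polytope_iff: "convex_full_polytope P \<longleftrightarrow> polytope P \<and> interior P \<noteq> {}"
  by (auto simp: convex_full_polytope_def polytope_eq_bounded_polyhedron)

lemma convex_full_polytope_isometry_image:
  assumes "isometry f" "convex_full_polytope P"
  shows "convex_full_polytope (f ` P)"
proof -
  obtain a A where A: "orthogonal_transformation A" "\<And>S. f ` S = (+) a ` A ` S"
    using assms(1) by (rule isometry_image_cong) blast
  then show ?thesis using assms(2)
    by (simp add: convex_full_polytope_iff polytope_translation_eq polytope_linear_image
        interior_translation interior_injective_linear_image
        orthogonal_transformation_linear orthogonal_transformation_inj)
qed

text \<open>The isometry \<open>g \<circ> inv f\<close> does it; bijectivity of \<open>f\<close> is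
  not part of \<open>isometry\<close> and comes from its orthogonal part.\<close>

lemma congruent_sets_isometry_images:
  assumes f: "isometry f" and g: "isometry g"
  shows "congruent_sets (f ` P) (g ` P)"
proof -
  obtain A where A: "orthogonal_transformation A" "f = (\<lambda>x. f 0 + A x)"
    using f by (rule isometry_orthogonal)
  have bij: "bij f"
  proof -
    have "bij ((+) (f 0) \<circ> A)"
      using A(1) by (intro bij_comp orthogonal_transformation_bij bij_plus)
    moreover have "(+) (f 0) \<circ> A = f"
      by (subst (2) A(2)) (simp add: comp_def)
    ultimately show ?thesis by simp
  qed
  have "isometry (inv f)"
    using f bij_inv_eq_iff[OF bij] unfolding isometry_def by metis
  then have "isometry (g \<circ> inv f)"
    using g by (simp add: isometry_def)
  moreover have "(g \<circ> inv f) ` f ` P = g ` P"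
    using bij by (simp add: image_comp bij_is_inj flip: o_assoc)
  ultimately show ?thesis
    unfolding congruent_sets_def by blast
qed

text \<open>Conjugating the reflection by \<open>f\<close> gives the reflection with base point
  \<open>f p\<close> and normal \<open>A a\<close>. Half turns and point reflections are transported
  in the same way below.\<close>

lemma has_plane_of_bilateral_symmetry_isometry_image:
  assumes "isometry f" "has_plane_of_bilateral_symmetry P"
  shows "has_plane_of_bilateral_symmetry (f ` P)"
proof -
  obtain A where A: "orthogonal_transformation A" "f = (\<lambda>x. f 0 + A x)"
    using assms(1) by (rule isometry_orthogonal)
  then have lin: "linear A" and inner: "\<And>x y. A x \<bullet> A y = x \<bullet> y"
    by (auto simp: orthogonal_transformation_def)
  obtain p a where pa: "a \<noteq> 0" "plane_reflection p a ` P = P"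
    using assms(2) unfolding has_plane_of_bilateral_symmetry_def by blast
  have f: "f x = f 0 + A x" for x
    using A(2) by metis
  have *: "plane_reflection (f p) (A a) (f x) = f (plane_reflection p a x)" for x
  proof -
    have "(f x - f p) \<bullet> A a = (x - p) \<bullet> a"
      by (simp add: f[of x] f[of p] inner flip: linear_diff[OF lin])
    then show ?thesis
      unfolding plane_reflection_def f[of "_ - _"]
      by (simp add: inner f[of x] linear_diff[OF lin] linear_scale[OF lin])
  qed
  have "A a \<noteq> 0"
    using inner[of a a] pa(1) by auto
  moreover have "plane_reflection (f p) (A a) ` f ` P = f ` P"
    using * pa(2) by (metis (no_types, lifting) image_cong image_image)
  ultimately show ?thesis
    unfolding has_plane_of_bilateral_symmetry_def by blast
qed

lemma has_line_of_half_turn_symmetry_isometry_image: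
  assumes "isometry f" "has_line_of_half_turn_symmetry P"
  shows "has_line_of_half_turn_symmetry (f ` P)"
proof -
  obtain A where A: "orthogonal_transformation A" "f = (\<lambda>x. f 0 + A x)"
    using assms(1) by (rule isometry_orthogonal)
  then have lin: "linear A" and inner: "\<And>x y. A x \<bullet> A y = x \<bullet> y"
    by (auto simp: orthogonal_transformation_def)
  obtain p a where pa: "a \<noteq> 0" "half_turn p a ` P = P"
    using assms(2) unfolding has_line_of_half_turn_symmetry_def by blast
  have f: "f x = f 0 + A x" for x
    using A(2) by metis
  have *: "half_turn (f p) (A a) (f x) = f (half_turn p a x)" for x
  proof -
    have "(f x - f p) \<bullet> A a = (x - p) \<bullet> a"
      by (simp add: f[of x] f[of p] inner flip: linear_diff[OF lin])
    then show ?thesis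
      unfolding half_turn_def Let_def f[of "_ - _"] linear_add[OF lin] linear_diff[OF lin] linear_scale[OF lin]
      by (simp add: inner f[of x] f[of p])
  qed
  have "A a \<noteq> 0"
    using inner[of a a] pa(1) by auto
  moreover have "half_turn (f p) (A a) ` f ` P = f ` P"
    using * pa(2) by (metis (no_types, lifting) image_cong image_image)
  ultimately show ?thesis
    unfolding has_line_of_half_turn_symmetry_def by blast
qed

lemma has_point_of_central_symmetry_isometry_image:
  assumes "isometry f" "has_point_of_central_symmetry P"
  shows "has_point_of_central_symmetry (f ` P)"
proof -
  obtain A where A: "orthogonal_transformation A" "f = (\<lambda>x. f 0 + A x)"
    using assms(1) by (rule isometry_orthogonal)
  then have lin: "linear A"
    by (auto simp: orthogonal_transformation_def)
  obtain c where c: "point_reflection c ` P = P"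
    using assms(2) unfolding has_point_of_central_symmetry_def by blast
  have f: "f x = f 0 + A x" for x
    using A(2) by metis
  have *: "point_reflection (f c) (f x) = f (point_reflection c x)" for x
    unfolding point_reflection_def f[of x] f[of c] f[of "c - _"] linear_diff[OF lin]
    by simp
  have "point_reflection (f c) ` f ` P = f ` P"
    using * c by (metis (no_types, lifting) image_cong image_image)
  then show ?thesis
    unfolding has_point_of_central_symmetry_def by blast
qed

lemma involution_image_eq:
  assumes "\<And>x. f (f x) = x" "\<And>x. x \<in> S \<Longrightarrow> f x \<in> S"
  shows "f ` S = S"
  using assms by (metis image_subsetI image_eqI subsetI subset_antisym)

text \<open>The iterates are pairwise distinct because a full-dimensional set cannot equal another one
  that it meets in dimension \<open>d - 1\<close>.\<close>

lemma neighborly_iterates: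
  fixes P :: "'a::euclidean_space set"
  assumes g: "isometry g" and P: "convex_full_polytope P"
    and dim: "\<And>d. 0 < d \<Longrightarrow> d < n \<Longrightarrow> aff_dim (P \<inter> (g ^^ d) ` P) = int DIM('a) - 1"
  shows "inj_on (\<lambda>i. (g ^^ i) ` P) {..<n}" "neighborly ((\<lambda>i. (g ^^ i) ` P) ` {..<n})"
proof -
  have less: "aff_dim ((g ^^ i) ` P \<inter> (g ^^ j) ` P) = int DIM('a) - 1" if "i < j" "j < n" for i j
  proof -
    \<comment> \<open>Taking out the injective \<open>g ^^ i\<close> turns the pair into the
      exponents 0 and \<open>j - i\<close>, the case covered by \<open>dim\<close>.\<close>
    have "g ^^ j = (g ^^ i) \<circ> (g ^^ (j - i))"
      using that(1) by (simp flip: funpow_add)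
    then have "(g ^^ i) ` P \<inter> (g ^^ j) ` P = (g ^^ i) ` (P \<inter> (g ^^ (j - i)) ` P)"
      using isometry_imp_inj[OF isometry_funpow[OF g]] by (simp add: image_Int image_comp)
    then show ?thesis
      using dim[of "j - i"] that by (simp add: aff_dim_isometry_image[OF isometry_funpow[OF g]])
  qed
  have ne: "aff_dim ((g ^^ i) ` P \<inter> (g ^^ j) ` P) = int DIM('a) - 1"
    if "i \<noteq> j" "i < n" "j < n" for i j
    using that less[of i j] less[of j i] by (metis Int_commute nat_neq_iff)
  have full: "aff_dim ((g ^^ i) ` P) = int DIM('a)" for i
    using convex_full_polytope_isometry_image[OF isometry_funpow[OF g] P]
    by (simp add: convex_full_polytope_def aff_dim_nonempty_interior)
  show "inj_on (\<lambda>i. (g ^^ i) ` P) {..<n}"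
  proof (rule inj_onI, rule ccontr)
    fix i j assume "i \<in> {..<n}" "j \<in> {..<n}" "(g ^^ i) ` P = (g ^^ j) ` P" "i \<noteq> j"
    then show False using ne[of i j] full[of j] by simp
  qed
  show "neighborly ((\<lambda>i. (g ^^ i) ` P) ` {..<n})"
    unfolding neighborly_def
  proof (intro ballI impI)
    fix Q R assume "Q \<in> (\<lambda>i. (g ^^ i) ` P) ` {..<n}" "R \<in> (\<lambda>i. (g ^^ i) ` P) ` {..<n}" "Q \<noteq> R"
    then obtain i j where ij: "Q = (g ^^ i) ` P" "R = (g ^^ j) ` P" "i < n" "j < n"
      by auto
    with \<open>Q \<noteq> R\<close> have "i \<noteq> j" by auto
    then show "aff_dim (Q \<inter> R) = int DIM('a) - 1"
      using ne ij by simp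
  qed
qed

section \<open>Bisectors\<close>

lemma dist_le_iff_inner:
  fixes a :: "'a::real_inner"
  shows "dist x a \<le> dist x b \<longleftrightarrow> (2 *\<^sub>R (b - a)) \<bullet> x \<le> b \<bullet> b - a \<bullet> a"
  unfolding dist_norm norm_le
  by (simp add: inner_diff_left inner_diff_right inner_commute algebra_simps)

lemma dist_eq_iff_inner:
  fixes a :: "'a::real_inner"
  shows "dist x a = dist x b \<longleftrightarrow> (2 *\<^sub>R (b - a)) \<bullet> x = b \<bullet> b - a \<bullet> a"
  unfolding dist_norm norm_eq
  by (auto simp: inner_diff_left inner_diff_right inner_commute algebra_simps)

lemma polyhedron_bisector_halfspace:
  fixes a :: "'a::euclidean_space"
  shows "polyhedron {x. dist x a \<le> dist x b}"
  unfolding dist_le_iff_inner by (rule polyhedron_halfspace_le)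

text \<open>\<open>S\<close> lies between the bisecting hyperplane and its part inside
  \<open>U\<close>. That part contains \<open>q\<close>, and cutting a convex set with an open set
  that meets it keeps the dimension.\<close>

lemma aff_dim_eq_bisector:
  fixes a b :: "'a::euclidean_space"
  assumes "a \<noteq> b" "open U" "q \<in> U" "dist q a = dist q b"
    and sub: "\<And>x. x \<in> S \<Longrightarrow> dist x a = dist x b"
    and sup: "\<And>x. x \<in> U \<Longrightarrow> dist x a = dist x b \<Longrightarrow> x \<in> S"
  shows "aff_dim S = int DIM('a) - 1"
proof -
  let ?H = "{x. dist x a = dist x b}"
  have H: "?H = {x. (2 *\<^sub>R (b - a)) \<bullet> x = b \<bullet> b - a \<bullet> a}"
    by (simp add: dist_eq_iff_inner)
  have dimH: "aff_dim ?H = int DIM('a) - 1"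
    unfolding H using assms(1) by (subst aff_dim_hyperplane) (auto simp: of_nat_diff)
  have "aff_dim (?H \<inter> U) = aff_dim ?H"
  proof (rule aff_dim_convex_Int_open)
    show "convex ?H" unfolding H by (rule convex_hyperplane)
  qed (use assms(2-4) in auto)
  moreover have "aff_dim (?H \<inter> U) \<le> aff_dim S" "aff_dim S \<le> aff_dim ?H"
    using sub sup by (auto intro!: aff_dim_subset)
  ultimately show ?thesis
    using dimH by simp
qed

section \<open>The helix\<close>

definition helix :: "real \<Rightarrow> real^3" where
  "helix u = vector [u, cos u, sin u]"

text \<open>Rotation angle and translation length agree, so the motion slides the helix along
  itself, adding \<open>u\<close> to its parameter.\<close>

definition screw :: "real \<Rightarrow> real^3 \<Rightarrow> real^3" where
  "screw u p = vector [p$1 + u, p$2 * cos u - p$3 * sin u, p$2 * sin u + p$3 * cos u]"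

lemma screw_screw: "screw u (screw v p) = screw (u + v) p"
  by (simp add: screw_def vec_eq_iff forall_3 cos_add sin_add algebra_simps)

lemma screw_0: "screw 0 p = p"
  by (simp add: screw_def vec_eq_iff forall_3)

lemma screw_helix: "screw u (helix v) = helix (u + v)"
  by (simp add: screw_def helix_def vec_eq_iff forall_3 cos_add sin_add algebra_simps)

lemma screw_funpow: "screw u ^^ k = screw (real k * u)"
  by (induction k) (auto simp: fun_eq_iff screw_0 screw_screw algebra_simps)

lemma mem_screw_image_iff: "p \<in> screw u ` S \<longleftrightarrow> screw (-u) p \<in> S"
  by (metis (no_types, lifting) add.left_inverse add.right_inverse image_iff screw_0 screw_screw)

lemma dist_vec3:
  "dist (x::real^3) y = sqrt ((x$1 - y$1)\<^sup>2 + (x$2 - y$2)\<^sup>2 + (x$3 - y$3)\<^sup>2)"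
  by (simp add: dist_norm norm_eq_sqrt_inner inner_vec_def sum_3 power2_eq_square)

lemma isometry_screw: "isometry (screw u)"
proof -
  have *: "(a * cos u - b * sin u)\<^sup>2 + (a * sin u + b * cos u)\<^sup>2 = a\<^sup>2 + b\<^sup>2" for a b :: real
    using sin_cos_squared_add[of u] by algebra
  have "dist (screw u p) (screw u q) = dist p q" for p q
    using *[of "p$2 - q$2" "p$3 - q$3"]
    by (simp add: screw_def dist_vec3 algebra_simps)
  then show ?thesis by (simp add: isometry_def)
qed

lemma dist_screw: "dist (screw u p) (screw u q) = dist p q"
  using isometry_screw by (simp add: isometry_def)

lemma dist_screw_helix: "dist (screw u p) (helix v) = dist p (helix (v - u))"
  using dist_screw[of u p "helix (v - u)"] by (simp add: screw_helix)

section \<open>Spheres touching the helix at two points\<close>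

lemma mult_cos_less_sin:
  fixes t :: real
  assumes "0 < t" "t < pi"
  shows "t * cos t < sin t"
proof -
  have "(\<lambda>t. sin t - t * cos t) 0 < (\<lambda>t. sin t - t * cos t) t"
  proof (rule DERIV_pos_imp_increasing_open[OF assms(1)])
    fix x assume "0 < x" "x < t"
    then have "0 < x * sin x" using assms(2) by (simp add: sin_gt_zero)
    moreover have "((\<lambda>t. sin t - t * cos t) has_real_derivative x * sin x) (at x)"
      by (auto intro!: derivative_eq_intros)
    ultimately show "\<exists>y. ((\<lambda>t. sin t - t * cos t) has_real_derivative y) (at x) \<and> 0 < y"
      by blast
  qed (auto intro!: continuous_intros)
  then show ?thesis by simp
qed

text \<open>The derivative of \<open>sin t / t\<close> has numerator
  \<open>t * cos t - sin t\<close>, negative by the preceding lemma. Clearing denominators gives the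
  form needed for the sign of the derivative in the next lemma.\<close>

lemma sinc_strict_decreasing:
  fixes x y :: real
  assumes "0 < x" "x < y" "y < pi"
  shows "x * sin y < y * sin x"
proof -
  have "sin y / y < sin x / x"
  proof (rule DERIV_neg_imp_decreasing[OF assms(2)])
    fix t assume t: "x \<le> t" "t \<le> y"
    then have "((\<lambda>t. sin t / t) has_real_derivative (t * cos t - sin t) / t\<^sup>2) (at t)"
      using assms by (auto intro!: derivative_eq_intros simp: power2_eq_square algebra_simps)
    moreover have "(t * cos t - sin t) / t\<^sup>2 < 0"
      using mult_cos_less_sin[of t] t assms by (simp add: divide_neg_pos)
    ultimately show "\<exists>y. ((\<lambda>t. sin t / t) has_real_derivative y) (at t) \<and> y < 0"
      by blast
  qed
  then show ?thesis
    using assms by (simp add: field_simps)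
qed

text \<open>Up to constants and a positive factor, both sides are squared distances from a point on the
  normal line of the helix at parameter 0 to the points with parameters \<open>u\<close> and \<open>w\<close>. As a
  function of \<open>w\<close>, the right-hand side has derivative \<open>2 * (w * sin u - u * sin w)\<close>, which for
  positive \<open>w\<close> changes sign only at \<open>w = u\<close>.\<close>

lemma tangent_sphere_ineq:
  fixes u w :: real
  assumes u: "0 < u" "u < pi" and w: "\<bar>w\<bar> < pi" "\<bar>w\<bar> \<noteq> u"
  shows "u\<^sup>2 * sin u + 2 * u * cos u < w\<^sup>2 * sin u + 2 * u * cos w"
proof -
  define f where "f w = w\<^sup>2 * sin u + 2 * u * cos w" for w
  have deriv: "(f has_real_derivative 2 * (t * sin u - u * sin t)) (at t)" for t
    unfolding f_def by (auto intro!: derivative_eq_intros)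
  have cont: "continuous_on S f" for S
    unfolding f_def by (auto intro!: continuous_intros)
  \<comment> \<open>\<open>f\<close> is even, so only the nonnegative side matters. The derivative
    vanishes at \<open>u\<close>, hence its sign is used on open intervals only.\<close>
  have "f u < f \<bar>w\<bar>"
  proof (cases "\<bar>w\<bar> < u")
    case True
    show ?thesis
    proof (rule DERIV_neg_imp_decreasing_open[OF True _ cont])
      fix t assume "\<bar>w\<bar> < t" "t < u"
      then have "2 * (t * sin u - u * sin t) < 0"
        using sinc_strict_decreasing[of t u] u by simp
      then show "\<exists>y. (f has_real_derivative y) (at t) \<and> y < 0"
        using deriv by blast
    qed
  next
    case False
    with w have less: "u < \<bar>w\<bar>" by simp
    show ?thesis
    proof (rule DERIV_pos_imp_increasing_open[OF less _ cont])
      fix t assume "u < t" "t < \<bar>w\<bar>"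
      then have "0 < 2 * (t * sin u - u * sin t)"
        using sinc_strict_decreasing[of u t] u w by (simp add: mult.commute)
      then show "\<exists>y. (f has_real_derivative y) (at t) \<and> 0 < y"
        using deriv by blast
    qed
  qed
  then show ?thesis by (simp add: f_def)
qed

text \<open>The centre of the sphere tangent to the helix at the parameters \<open>u\<close> and \<open>- u\<close>.\<close>

definition touch :: "real \<Rightarrow> real^3" where
  "touch u = vector [0, - u / sin u, 0]"

text \<open>Up to a summand independent of \<open>w\<close>, the squared distance is the right-hand
  side of the tangent sphere inequality divided by \<open>sin u > 0\<close>. The parameters
  \<open>u\<close> and \<open>- u\<close> are excluded because both points lie on the
  sphere.\<close>

lemma dist_touch_helix_less:
  assumes "0 < u" "u < pi" "\<bar>w\<bar> < pi" "\<bar>w\<bar> \<noteq> u"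
  shows "dist (touch u) (helix u) < dist (touch u) (helix w)"
proof -
  have s: "sin u > 0" using assms by (simp add: sin_gt_zero)
  have *: "w\<^sup>2 + (- u / sin u - cos w)\<^sup>2 + (sin w)\<^sup>2
      = (w\<^sup>2 * sin u + 2 * u * cos w) / sin u + (u / sin u)\<^sup>2 + 1" for w
  proof -
    have "(- u / sin u - cos w)\<^sup>2 + (sin w)\<^sup>2 = (u / sin u)\<^sup>2 + 2 * (u / sin u) * cos w + 1"
      using sin_cos_squared_add[of w] by (simp add: power2_eq_square algebra_simps)
    then show ?thesis using s by (simp add: field_simps)
  qed
  have "dist (touch u) (helix w) = sqrt (w\<^sup>2 + (- u / sin u - cos w)\<^sup>2 + (sin w)\<^sup>2)" for w
    by (simp add: touch_def helix_def dist_vec3)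
  then have "dist (touch u) (helix w)
      = sqrt ((w\<^sup>2 * sin u + 2 * u * cos w) / sin u + (u / sin u)\<^sup>2 + 1)" for w
    unfolding * .
  then show ?thesis
    using tangent_sphere_ineq[OF assms] s by (simp add: divide_strict_right_mono)
qed

lemma dist_touch_helix_minus: "dist (touch u) (helix (- u)) = dist (touch u) (helix u)"
  by (simp add: touch_def helix_def dist_vec3)

section \<open>The symmetrized cell\<close>

definition mirror :: "real \<Rightarrow> real^3 \<Rightarrow> real^3" where
  "mirror M p = vector [p$1, 2 * M - p$2, p$3]"

text \<open>The half turn about the normal line of the helix at parameter 0; it sends the helix
  parameter \<open>u\<close> to \<open>- u\<close>.\<close>

definition flip :: "real^3 \<Rightarrow> real^3" where
  "flip p = vector [- p$1, p$2, - p$3]"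

text \<open>For \<open>M > 0\<close> this is a cube centred on the mirror plane; its half-side
  \<open>2 * M\<close> lets it contain the ball of radius \<open>M\<close> about the origin.\<close>

definition box3 :: "real \<Rightarrow> (real^3) set" where
  "box3 M = cbox (vector [- (2 * M), - M, - (2 * M)]) (vector [2 * M, 3 * M, 2 * M])"

text \<open>A Voronoi region, with \<open>K\<close> meant as a set of parameter differences: the
  screw by \<open>d\<close> carries it to the region of \<open>helix d\<close> against the
  parameters \<open>u + d\<close>. So all regions are congruent although a finite set of helix
  points is not invariant under the screw.\<close>

definition region :: "real set \<Rightarrow> (real^3) set" where
  "region K = {p. \<forall>u\<in>K. dist p (helix 0) \<le> dist p (helix u)}"

definition cell :: "real set \<Rightarrow> real \<Rightarrow> (real^3) set" where
  "cell K M = region K \<inter> {p. mirror M p \<in> region K} \<inter> box3 M"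

lemma mirror_nth [simp]:
  "mirror M p $ 1 = p $ 1" "mirror M p $ 2 = 2 * M - p $ 2" "mirror M p $ 3 = p $ 3"
  by (simp_all add: mirror_def)

lemma flip_nth [simp]: "flip p $ 1 = - p $ 1" "flip p $ 2 = p $ 2" "flip p $ 3 = - p $ 3"
  by (simp_all add: flip_def)

lemma mem_box3:
  "p \<in> box3 M \<longleftrightarrow> \<bar>p$1\<bar> \<le> 2 * M \<and> \<bar>p$2 - M\<bar> \<le> 2 * M \<and> \<bar>p$3\<bar> \<le> 2 * M"
  unfolding box3_def by (auto simp: mem_box_cart forall_3)

lemma mirror_mirror: "mirror M (mirror M p) = p"
  by (simp add: mirror_def vec_eq_iff forall_3)

lemma flip_flip: "flip (flip p) = p"
  by (simp add: flip_def vec_eq_iff forall_3)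

lemma dist_mirror: "dist (mirror M p) q = dist p (mirror M q)"
  by (simp add: dist_vec3 mirror_def power2_eq_square algebra_simps)

lemma dist_flip_helix: "dist (flip p) (helix u) = dist p (helix (- u))"
  by (simp add: dist_vec3 flip_def helix_def power2_eq_square algebra_simps)

lemma polyhedron_region:
  assumes "finite K"
  shows "polyhedron (region K)" "polyhedron {p. mirror M p \<in> region K}"
proof -
  have "region K = (\<Inter>u\<in>K. {p. dist p (helix 0) \<le> dist p (helix u)})"
    by (auto simp: region_def)
  with assms show "polyhedron (region K)"
    by (auto intro!: polyhedron_Inter polyhedron_bisector_halfspace)
  have "{p. mirror M p \<in> region K}
      = (\<Inter>u\<in>K. {p. dist p (mirror M (helix 0)) \<le> dist p (mirror M (helix u))})"
    by (auto simp: region_def dist_mirror)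
  with assms show "polyhedron {p. mirror M p \<in> region K}"
    by (auto intro!: polyhedron_Inter polyhedron_bisector_halfspace)
qed

section \<open>Symmetries of the cell\<close>

lemma mirror_mem_cell: "p \<in> cell K M \<Longrightarrow> mirror M p \<in> cell K M"
  by (auto simp: cell_def mirror_mirror mem_box3)

lemma flip_mem_region:
  assumes "uminus ` K \<subseteq> K" "p \<in> region K"
  shows "flip p \<in> region K"
  using assms by (auto simp: region_def dist_flip_helix)

lemma flip_mem_cell:
  assumes "uminus ` K \<subseteq> K" "p \<in> cell K M"
  shows "flip p \<in> cell K M"
proof -
  have "mirror M (flip p) = flip (mirror M p)"
    by (simp add: mirror_def flip_def)
  then show ?thesis
    using assms flip_mem_region[OF assms(1)] by (auto simp: cell_def mem_box3)
qed

lemma cell_symmetries: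
  assumes K: "uminus ` K \<subseteq> K"
  shows "has_plane_of_bilateral_symmetry (cell K M)"
    and "has_line_of_half_turn_symmetry (cell K M)"
    and "has_point_of_central_symmetry (cell K M)"
proof -
  \<comment> \<open>The axis of \<open>flip\<close> has direction \<open>e\<close> and meets the
    mirror plane orthogonally in \<open>c\<close>, so \<open>c\<close> serves as base point of both
    and as the centre.\<close>
  define c :: "real^3" where "c = vector [0, M, 0]"
  define e :: "real^3" where "e = vector [0, 1, 0]"
  have ee: "e \<bullet> e = 1" and pe: "p \<bullet> e = p$2" for p
    by (simp_all add: e_def inner_vec_def sum_3)
  have e: "e \<noteq> 0" using ee by auto
  have nth: "c$1 = 0" "c$2 = M" "c$3 = 0" "e$1 = 0" "e$2 = 1" "e$3 = 0"
    by (simp_all add: c_def e_def)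
  have "plane_reflection c e = mirror M"
    by (simp add: plane_reflection_def ee pe fun_eq_iff vec_eq_iff forall_3 nth)
  moreover have "mirror M ` cell K M = cell K M"
    by (rule involution_image_eq) (auto simp: mirror_mirror mirror_mem_cell)
  ultimately show "has_plane_of_bilateral_symmetry (cell K M)"
    unfolding has_plane_of_bilateral_symmetry_def using e by metis
  have "half_turn c e = flip"
    by (simp add: half_turn_def ee pe fun_eq_iff vec_eq_iff forall_3 nth Let_def)
  moreover have "flip ` cell K M = cell K M"
    by (rule involution_image_eq) (auto simp: flip_flip flip_mem_cell[OF K])
  ultimately show "has_line_of_half_turn_symmetry (cell K M)"
    unfolding has_line_of_half_turn_symmetry_def using e by metis
  have commute: "mirror M (flip p) = flip (mirror M p)" for p
    by (simp add: vec_eq_iff forall_3)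
  have "point_reflection c p = flip (mirror M p)" for p
    by (simp add: point_reflection_def vec_eq_iff forall_3 nth)
  then have "point_reflection c ` cell K M = cell K M"
    by (intro involution_image_eq) (auto simp: flip_mem_cell[OF K] mirror_mem_cell
        mirror_mirror flip_flip commute)
  then show "has_point_of_central_symmetry (cell K M)"
    unfolding has_point_of_central_symmetry_def by blast
qed

section \<open>Room near the origin, full dimension and contacts\<close>

lemma dist_helix_le_iff:
  "dist p (helix 0) \<le> dist p (helix u) \<longleftrightarrow> 2 * (p$1 * u - p$2 * (1 - cos u) + p$3 * sin u) \<le> u\<^sup>2"
proof -
  have "dist p (helix u) = sqrt ((p$1)\<^sup>2 + (p$2)\<^sup>2 + (p$3)\<^sup>2 + 1 + u\<^sup>2
      - 2 * (p$1 * u + p$2 * cos u + p$3 * sin u))" for u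
    using sin_cos_squared_add[of u]
    by (simp add: dist_vec3 helix_def) (simp add: power2_eq_square algebra_simps)
  then show ?thesis
    by (simp add: algebra_simps)
qed

lemma cos_less_one:
  fixes u :: real
  assumes "\<bar>u\<bar> \<le> 1" "u \<noteq> 0"
  shows "cos u < 1"
proof -
  have "cos \<bar>u\<bar> < cos 0"
    using assms pi_gt3 by (intro cos_monotone_0_pi) auto
  then show ?thesis by simp
qed

text \<open>The reflected region widens around the origin as the mirror recedes, since the reflected
  point lies ever farther out on the normal line of the helix at parameter 0.\<close>

lemma ball_subset_mirror_region_box:
  assumes "finite K" "\<And>u. u \<in> K \<Longrightarrow> \<bar>u\<bar> \<le> 1"
  obtains M where "M > 0" "ball 0 B \<subseteq> {p. mirror M p \<in> region K} \<inter> box3 M"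
proof -
  \<comment> \<open>For such \<open>M\<close>, \<open>M * (1 - cos u)\<close> is at least
    \<open>2 * \<bar>B\<bar>\<close>, which bounds the sum of the terms with \<open>p$1\<close> and
    \<open>p$3\<close> in \<open>dist_helix_le_iff\<close>. At \<open>u = 0\<close> the quotient is
    0 by the convention for division by zero.\<close>
  have "eventually (\<lambda>M. \<forall>u\<in>K. 2 * \<bar>B\<bar> / (1 - cos u) \<le> M) at_top"
    using assms(1) by (simp add: eventually_ball_finite eventually_ge_at_top)
  moreover have "eventually (\<lambda>M. \<bar>B\<bar> < M) at_top"
    by (rule eventually_gt_at_top)
  ultimately have "eventually (\<lambda>M. (\<forall>u\<in>K. 2 * \<bar>B\<bar> / (1 - cos u) \<le> M) \<and> \<bar>B\<bar> < M) at_top"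
    by (rule eventually_conj)
  then obtain M where M: "\<And>u. u \<in> K \<Longrightarrow> 2 * \<bar>B\<bar> / (1 - cos u) \<le> M" "\<bar>B\<bar> < M"
    using eventually_happens by fastforce
  have "p \<in> {p. mirror M p \<in> region K} \<inter> box3 M" if "p \<in> ball 0 B" for p
  proof -
    have comp: "\<bar>p$i\<bar> \<le> \<bar>B\<bar>" for i
      using component_le_norm_cart[of p i] that by auto
    have "dist (mirror M p) (helix 0) \<le> dist (mirror M p) (helix u)" if u: "u \<in> K" for u
    proof (cases "u = 0")
      case False
      then have c: "cos u < 1" using cos_less_one assms(2) u by blast
      have "2 * \<bar>B\<bar> \<le> M * (1 - cos u)"
        using M(1)[OF u] c by (simp add: field_simps)
      moreover have "p$2 * (1 - cos u) \<le> M * (1 - cos u)"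
        using comp[of 2] M(2) c by (intro mult_right_mono) auto
      moreover have "\<bar>p$1 * u\<bar> \<le> \<bar>B\<bar> * 1" "\<bar>p$3 * sin u\<bar> \<le> \<bar>B\<bar> * 1"
        unfolding abs_mult using comp assms(2)[OF u] by (intro mult_mono; simp)+
      \<comment> \<open>Of the two summands in \<open>2 * M\<close>, one outweighs
        \<open>p$2\<close> and the other the terms with \<open>p$1\<close> and
        \<open>p$3\<close>.\<close>
      ultimately have "p$1 * u - (2 * M - p$2) * (1 - cos u) + p$3 * sin u \<le> 0"
        by (simp add: left_diff_distrib)
      then show ?thesis
        unfolding dist_helix_le_iff by (simp add: mirror_def order_trans[OF _ zero_le_power2])
    qed simp
    moreover have "p \<in> box3 M"
      using comp[of 1] comp[of 2] comp[of 3] M(2) by (auto simp: mem_box3)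
    ultimately show ?thesis by (simp add: region_def)
  qed
  moreover have "M > 0" using M(2) by simp
  ultimately show thesis by (intro that subsetI)
qed

text \<open>For the interior: the point \<open>c\<close> on the normal line and the mirror plane is
  strictly closer to \<open>helix 0\<close> than to any other helix point, and it is fixed by the
  mirror. Finitely many strict inequalities then cut out an open set around it inside the
  cell.\<close>

lemma convex_full_polytope_cell:
  assumes K: "finite K" and M: "M > 0"
  shows "convex_full_polytope (cell K M)"
proof -
  have box: "polytope (box3 M)"
    by (simp add: box3_def polytope_interval)
  have poly: "polyhedron (cell K M)"
    unfolding cell_def using polyhedron_region[OF K] box
    by (intro polyhedron_Int) (auto simp: polytope_eq_bounded_polyhedron)
  have bdd: "bounded (cell K M)"
    unfolding cell_def using box by (meson bounded_Int polytope_imp_bounded)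
  define c :: "real^3" where "c = vector [0, M, 0]"
  \<comment> \<open>The parameter 0 is left out because its inequality compares
    \<open>helix 0\<close> with itself and can never be strict.\<close>
  define U where "U = (\<Inter>u\<in>K - {0}. {p. dist p (helix 0) < dist p (helix u)}
      \<inter> {p. dist p (mirror M (helix 0)) < dist p (mirror M (helix u))})
    \<inter> box (vector [- (2 * M), - M, - (2 * M)]) (vector [2 * M, 3 * M, 2 * M])"
  have "open U"
    unfolding U_def using K by (auto intro!: open_INT open_Int open_Collect_less continuous_intros)
  moreover have "U \<subseteq> cell K M"
  proof
    fix p assume p: "p \<in> U"
    have "p \<in> box3 M"
      using p box_subset_cbox unfolding U_def box3_def by blast
    moreover have "dist p (helix 0) \<le> dist p (helix u) \<and>
        dist (mirror M p) (helix 0) \<le> dist (mirror M p) (helix u)" if "u \<in> K" for u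
      using p that by (cases "u = 0") (auto simp: U_def dist_mirror intro!: less_imp_le)
    ultimately show "p \<in> cell K M"
      by (auto simp: cell_def region_def)
  qed
  moreover have "c \<in> U"
  proof -
    have fix_c: "mirror M c = c"
      by (simp add: mirror_def c_def)
    have "dist c (helix 0) < dist c (helix u)" if "u \<noteq> 0" for u
    proof -
      have *: "dist c (helix u) = sqrt (u\<^sup>2 + (M - 1)\<^sup>2 + 2 * M * (1 - cos u))" for u
      proof -
        have "u\<^sup>2 + (M - cos u)\<^sup>2 + (sin u)\<^sup>2 = u\<^sup>2 + (M - 1)\<^sup>2 + 2 * M * (1 - cos u)"
          using sin_cos_squared_add[of u] by (simp add: power2_eq_square algebra_simps)
        then show ?thesis by (simp add: dist_vec3 c_def helix_def)
      qed
      have "0 < u\<^sup>2" "0 \<le> M * (1 - cos u)"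
        using that M by auto
      then have "0 < u\<^sup>2 + 2 * (M * (1 - cos u))"
        by linarith
      then have "0\<^sup>2 + (M - 1)\<^sup>2 + 2 * M * (1 - cos 0) < u\<^sup>2 + (M - 1)\<^sup>2 + 2 * M * (1 - cos u)"
        by simp
      then show ?thesis unfolding * by (rule real_sqrt_less_mono)
    qed
    then show ?thesis
      using M by (auto simp: U_def mem_box_cart forall_3 fix_c simp flip: dist_mirror)
        (auto simp: c_def)
  qed
  ultimately have "interior (cell K M) \<noteq> {}"
    using interior_maximal by blast
  then show ?thesis
    using poly bdd by (simp add: convex_full_polytope_def)
qed

text \<open>Screwing \<open>touch (d / 2)\<close> by \<open>d / 2\<close> gives the centre
  \<open>q\<close> of the sphere tangent to the helix at the parameters 0 and \<open>d\<close>. All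
  other inequalities of the two regions are strict at \<open>q\<close>, so near \<open>q\<close> the
  intersection is exactly the bisecting plane. The bounds by \<open>B\<close> make the mirrored
  region and the box automatic there for both cells.\<close>

lemma aff_dim_cell_Int_screw_cell:
  assumes K: "finite K" "\<And>u. u \<in> K \<Longrightarrow> \<bar>u\<bar> \<le> 1"
    and d: "0 < d" "d \<in> K" "- d \<in> K"
    and B: "norm (screw (d / 2) (touch (d / 2))) < B" "norm (screw (- d / 2) (touch (d / 2))) < B"
    and M: "ball 0 B \<subseteq> {p. mirror M p \<in> region K} \<inter> box3 M"
  shows "aff_dim (cell K M \<inter> screw d ` cell K M) = 2"
proof -
  define q where "q = screw (d / 2) (touch (d / 2))"
  \<comment> \<open>These are the inequalities of the region of \<open>helix 0\<close> and, shifted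
    by \<open>d\<close>, of that of \<open>helix d\<close>. The excluded parameters are those
    comparing \<open>helix 0\<close> and \<open>helix d\<close> with themselves or with each
    other.\<close>
  define N where "N p = ((\<forall>u\<in>K - {0, d}. dist p (helix 0) < dist p (helix u))
    \<and> (\<forall>u\<in>K - {0, - d}. dist p (helix d) < dist p (helix (u + d))))" for p
  \<comment> \<open>The last condition says that \<open>screw (- d) p\<close> lies in
    \<open>ball 0 B\<close>.\<close>
  define U where "U = {p. N p} \<inter> ball 0 B \<inter> {p. dist p (screw d 0) < B}"
  \<comment> \<open>Seen from the midpoint \<open>d / 2\<close>, all parameters involved are at
    distance at most \<open>1 + d / 2 \<le> 3 / 2\<close>, below \<open>pi\<close> as
    \<open>dist_touch_helix_less\<close> requires.\<close>
  have pi: "3 / 2 < pi" using pi_gt3 by simp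
  have dle: "d \<le> 1" using K(2)[OF d(2)] by simp
  have q_dist: "dist q (helix v) = dist (touch (d / 2)) (helix (v - d / 2))" for v
    by (simp add: q_def dist_screw_helix)
  have q_eq: "dist q (helix 0) = dist q (helix d)"
    by (simp add: q_dist dist_touch_helix_minus)
  have q_less: "dist q (helix d) < dist q (helix v)" if "v \<noteq> 0" "v \<noteq> d" "\<bar>v - d / 2\<bar> \<le> 3 / 2" for v
    unfolding q_dist using dist_touch_helix_less[of "d / 2" "v - d / 2"] that pi d(1) dle
    by (auto simp: abs_if split: if_splits)
  have cell_iff: "p \<in> cell K M \<longleftrightarrow> p \<in> region K" if "p \<in> ball 0 B" for p
    using M that by (auto simp: cell_def)
  have screw_region: "screw (- d) p \<in> region K \<longleftrightarrow>
      (\<forall>u\<in>K. dist p (helix d) \<le> dist p (helix (u + d)))" for p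
    by (simp add: region_def dist_screw_helix)
  have ball_screw: "screw (- d) p \<in> ball 0 B \<longleftrightarrow> dist p (screw d 0) < B" for p
    using dist_screw[of "- d" p "screw d 0"] by (simp add: screw_screw screw_0 dist_commute)
  have open_U: "open U"
  proof -
    have "{p. N p} = (\<Inter>u\<in>K - {0, d}. {p. dist p (helix 0) < dist p (helix u)})
        \<inter> (\<Inter>u\<in>K - {0, - d}. {p. dist p (helix d) < dist p (helix (u + d))})"
      by (auto simp: N_def)
    then show ?thesis
      unfolding U_def using K(1)
      by (auto intro!: open_INT open_Int open_Collect_less continuous_intros)
  qed
  have q_U: "q \<in> U"
  proof -
    have "N q"
      unfolding N_def
    proof (intro conjI ballI)
      fix u assume u: "u \<in> K - {0, d}"
      then show "dist q (helix 0) < dist q (helix u)"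
        unfolding q_eq using K(2)[of u] dle d(1) by (intro q_less) (auto simp: abs_if split: if_splits)
    next
      fix u assume u: "u \<in> K - {0, - d}"
      then show "dist q (helix d) < dist q (helix (u + d))"
        using K(2)[of u] dle d(1) by (intro q_less) (auto simp: abs_if split: if_splits)
    qed
    moreover have "screw (- d) q = screw (- d / 2) (touch (d / 2))"
      by (simp add: q_def screw_screw)
    then have "dist q (screw d 0) < B"
      using B(2) by (simp flip: ball_screw)
    moreover have "q \<in> ball 0 B"
      using B(1) by (simp add: q_def)
    ultimately show ?thesis
      by (simp add: U_def)
  qed
  have sup: "x \<in> cell K M \<inter> screw d ` cell K M"
    if x: "x \<in> U" and eq: "dist x (helix 0) = dist x (helix d)" for x
  proof -
    have "N x" using x by (simp add: U_def)
    have "dist x (helix 0) \<le> dist x (helix u)" if "u \<in> K" for u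
      using \<open>N x\<close> that eq unfolding N_def by (metis Diff_iff insertE empty_iff less_imp_le order_refl)
    then have "x \<in> region K"
      by (simp add: region_def)
    moreover have "dist x (helix d) \<le> dist x (helix (u + d))" if "u \<in> K" for u
    proof (cases "u = 0 \<or> u = - d")
      case True
      then show ?thesis using eq by auto
    next
      case False
      then show ?thesis using \<open>N x\<close> that by (auto simp: N_def intro!: less_imp_le)
    qed
    then have "screw (- d) x \<in> region K"
      by (simp add: screw_region)
    moreover have "x \<in> ball 0 B" "screw (- d) x \<in> ball 0 B"
      unfolding ball_screw using x by (auto simp: U_def)
    ultimately show ?thesis
      by (simp add: mem_screw_image_iff cell_iff)
  qed
  \<comment> \<open>Each of the two regions contributes one inequality, through
    \<open>d \<in> K\<close> and \<open>- d \<in> K\<close> respectively.\<close>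
  have sub: "dist x (helix 0) = dist x (helix d)" if "x \<in> cell K M \<inter> screw d ` cell K M" for x
  proof (rule antisym)
    show "dist x (helix 0) \<le> dist x (helix d)"
      using that d(2) by (auto simp: cell_def region_def)
    have "screw (- d) x \<in> region K"
      using that by (simp add: mem_screw_image_iff cell_def)
    then show "dist x (helix d) \<le> dist x (helix 0)"
      using d(3) by (fastforce simp: screw_region)
  qed
  have "helix 0 \<noteq> helix d"
    using d(1) by (simp add: helix_def vec_eq_iff forall_3)
  then have "aff_dim (cell K M \<inter> screw d ` cell K M) = int DIM(real^3) - 1"
    using open_U q_U q_eq sub sup by (rule aff_dim_eq_bisector)
  then show ?thesis by simp
qed

section \<open>A family of screw images of one cell\<close>

theorem theorem3:
  fixes n :: nat
  assumes "n > 0"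
  shows "\<exists>F :: (real^3) set set.
           finite F \<and> card F = n \<and>
           (\<forall>P\<in>F. convex_full_polytope P) \<and>
           neighborly F \<and>
           (\<forall>P\<in>F. \<forall>Q\<in>F. congruent_sets P Q) \<and>
           (\<forall>P\<in>F. has_plane_of_bilateral_symmetry P \<and>
                   has_line_of_half_turn_symmetry P \<and>
                   has_point_of_central_symmetry P)"
proof -
  \<comment> \<open>\<open>K\<close> contains all differences of the parameters \<open>i / n\<close>
    with \<open>i < n\<close>; the spacing \<open>1 / n\<close> keeps it inside the interval from -1
    to 1.\<close>
  define K where "K = (\<lambda>k. real_of_int k / real n) ` {- int n..int n}"
  have K_fin: "finite K" by (simp add: K_def)
  have K_le: "\<bar>u\<bar> \<le> 1" if "u \<in> K" for u
  proof -
    obtain k where k: "u = real_of_int k / real n" "k \<in> {- int n..int n}"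
      using \<open>u \<in> K\<close> unfolding K_def by blast
    have "\<bar>real_of_int k\<bar> \<le> real n" using k(2) by auto
    then show ?thesis using assms by (simp add: k(1) abs_divide)
  qed
  have K_minus: "uminus ` K \<subseteq> K"
  proof -
    have "- (real_of_int k / real n) \<in> K" if "k \<in> {- int n..int n}" for k
      unfolding K_def using that by (intro image_eqI[of _ _ "- k"]) auto
    then show ?thesis by (auto simp: K_def)
  qed
  have K_mem: "real d / real n \<in> K" if "d < n" for d
    unfolding K_def using that by (intro image_eqI[of _ _ "int d"]) auto
  define h where "h d = real d / real n" for d
  \<comment> \<open>The contact centres as seen from both cells of each pair. One bound
    \<open>B\<close> for this finite set gives one \<open>M\<close> for all pairs at once; the index
    0 contributes only the origin.\<close>
  define X where "X = (\<Union>d<n. {screw (h d / 2) (touch (h d / 2)), screw (- h d / 2) (touch (h d / 2))})"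
  have "bounded X" by (auto simp: X_def intro!: finite_imp_bounded)
  then obtain B where B: "\<And>x. x \<in> X \<Longrightarrow> norm x < B"
    by (metis bounded_pos_less)
  obtain M where M: "M > 0" "ball 0 B \<subseteq> {p. mirror M p \<in> region K} \<inter> box3 M"
    using ball_subset_mirror_region_box[OF K_fin K_le] by blast
  define P where "P = cell K M"
  define g where "g = screw (1 / real n)"
  have P: "convex_full_polytope P"
    unfolding P_def by (rule convex_full_polytope_cell[OF K_fin M(1)])
  have g: "isometry g" unfolding g_def by (rule isometry_screw)
  have pow: "g ^^ d = screw (h d)" for d
    by (simp add: g_def h_def screw_funpow)
  have dim: "aff_dim (P \<inter> (g ^^ d) ` P) = int DIM(real^3) - 1" if "0 < d" "d < n" for d
  proof -
    have "h d \<in> K" "- h d \<in> K" "0 < h d"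
      using K_mem[OF that(2)] K_minus that assms by (auto simp: h_def)
    then have "aff_dim (P \<inter> screw (h d) ` P) = 2"
      unfolding P_def using that(2) M(2)
      by (intro aff_dim_cell_Int_screw_cell[OF K_fin K_le]) (auto intro!: B simp: X_def)
    then show ?thesis by (simp add: pow)
  qed
  define F where "F = (\<lambda>i. (g ^^ i) ` P) ` {..<n}"
  have iso: "isometry (g ^^ i)" for i by (rule isometry_funpow[OF g])
  have "card F = n"
    unfolding F_def using neighborly_iterates(1)[OF g P dim] by (simp add: card_image)
  moreover have "neighborly F"
    unfolding F_def by (rule neighborly_iterates(2)[OF g P dim])
  moreover have "\<forall>P\<in>F. convex_full_polytope P"
    unfolding F_def using convex_full_polytope_isometry_image[OF iso P] by blast
  moreover have "\<forall>P\<in>F. \<forall>Q\<in>F. congruent_sets P Q"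
    unfolding F_def using congruent_sets_isometry_images[OF iso iso] by blast
  moreover have "\<forall>P\<in>F. has_plane_of_bilateral_symmetry P \<and> has_line_of_half_turn_symmetry P \<and>
      has_point_of_central_symmetry P"
    unfolding F_def P_def using cell_symmetries[OF K_minus] iso
    by (auto intro: has_plane_of_bilateral_symmetry_isometry_image
        has_line_of_half_turn_symmetry_isometry_image has_point_of_central_symmetry_isometry_image)
  moreover have "finite F" by (simp add: F_def)
  ultimately show ?thesis by blast
qed

end
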